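(* Let $k$ be a field of characteristic zero, and let $m\geq 2$ and $\alpha\geq 1$ be integers. For $n\geq 3$, let $$d_n=(1-x_1x_2^{\alpha})\partial_{x_1}+x_1^m\partial_{x_2}+x_2\partial_{x_3}+\dots+x_{n-1}\partial_{x_n}$$ be the $k$-derivation of $R_n=k[x_1,\dots,x_n]$. Then $$\mathrm{Aut}(R_n)_{d_n}=\{(x_1,x_2,\dots,x_{n-1},x_n+c)\mid c\in k\}.$$
   Context: A $k$-derivation of $R_n$ is a $k$-linear map $d:R_n\to R_n$ with $d(ab)=a\,d(b)+d(a)\,b$ for all $a,b$. $\partial_{x_i}$ denotes the partial derivative with respect to $x_i$, so $d_n(x_1)=1-x_1x_2^{\alpha}$, $d_n(x_2)=x_1^m$, and $d_n(x_i)=x_{i-1}$ for $3\leq i\leq n$. $\mathrm{Aut}(R_n)$ denotes the group of $k$-algebra automorphisms of $R_n$. For a $k$-derivation $d$ of $R_n$, the isotropy group of $d$ is $\mathrm{Aut}(R_n)_d=\{\rho\in\mathrm{Aut}(R_n)\mid d\rho=\rho d\}$. A $k$-automorphism $\rho$ of $R_n$ is written as $(g_1,\dots,g_n)$, where $g_i=\rho(x_i)\in R_n$ for $1\leq i\leq n$. *)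

theory Defs
  imports "HOL-Library.Poly_Mapping" "HOL-Library.FuncSet"
begin

text \<open>
  Polynomials over \<open>'k\<close> in the variables \<open>x\<^sub>0, x\<^sub>1, x\<^sub>2, \<dots>\<close> are finitely supported functions on
  exponent vectors, and the ring \<open>k[x\<^sub>1, \<dots>, x\<^sub>n]\<close> is the subset of those polynomials that
  involve only \<open>x\<^sub>1, \<dots>, x\<^sub>n\<close>; hence \<open>n\<close> is an ordinary natural number.
\<close>

type_synonym 'k mpoly = "(nat \<Rightarrow>\<^sub>0 nat) \<Rightarrow>\<^sub>0 'k"

definition Const :: "'k \<Rightarrow> 'k::comm_ring_1 mpoly" where
  "Const c = Poly_Mapping.single 0 c"

definition Var :: "nat \<Rightarrow> 'k::comm_ring_1 mpoly" where
  "Var i = Poly_Mapping.single (Poly_Mapping.single i 1) 1"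

definition R :: "nat \<Rightarrow> 'k::comm_ring_1 mpoly set" where
  "R n = {p. \<forall>s \<in> Poly_Mapping.keys p. Poly_Mapping.keys s \<subseteq> {1..n}}"

text \<open>
  The truncated subtraction on exponents is harmless: if the exponent of \<open>x\<^sub>i\<close> is \<open>0\<close>, so is
  the coefficient.
\<close>

definition pderivative :: "nat \<Rightarrow> 'k::comm_ring_1 mpoly \<Rightarrow> 'k mpoly" where
  "pderivative i p = (\<Sum>s \<in> Poly_Mapping.keys p.
     Poly_Mapping.single (s - Poly_Mapping.single i 1)
       (of_nat (Poly_Mapping.lookup s i) * Poly_Mapping.lookup p s))"

definition k_derivation :: "nat \<Rightarrow> ('k::comm_ring_1 mpoly \<Rightarrow> 'k mpoly) \<Rightarrow> bool" where
  "k_derivation n D \<longleftrightarrow>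
     (\<forall>p \<in> R n. D p \<in> R n) \<and>
     (\<forall>p \<in> R n. \<forall>q \<in> R n. D (p + q) = D p + D q) \<and>
     (\<forall>c. \<forall>p \<in> R n. D (Const c * p) = Const c * D p) \<and>
     (\<forall>p \<in> R n. \<forall>q \<in> R n. D (p * q) = p * D q + D p * q)"

definition d :: "nat \<Rightarrow> nat \<Rightarrow> nat \<Rightarrow> 'k::comm_ring_1 mpoly \<Rightarrow> 'k mpoly" where
  "d m \<alpha> n p =
     (1 - Var 1 * Var 2 ^ \<alpha>) * pderivative 1 p + Var 1 ^ m * pderivative 2 p
     + (\<Sum>i = 3..n. Var (i - 1) * pderivative i p)"

text \<open>
  Maps from \<open>k[x\<^sub>1, \<dots>, x\<^sub>n]\<close> to itself are represented by functions that are \<open>undefined\<close>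
  outside \<open>R n\<close>, so that equality of functions is equality on \<open>R n\<close>.
\<close>

definition Aut :: "nat \<Rightarrow> ('k::comm_ring_1 mpoly \<Rightarrow> 'k mpoly) set" where
  "Aut n = {\<rho>. \<rho> \<in> extensional (R n) \<and> bij_betw \<rho> (R n) (R n) \<and>
     (\<forall>p \<in> R n. \<forall>q \<in> R n. \<rho> (p + q) = \<rho> p + \<rho> q) \<and>
     (\<forall>p \<in> R n. \<forall>q \<in> R n. \<rho> (p * q) = \<rho> p * \<rho> q) \<and>
     (\<forall>c. \<rho> (Const c) = Const c)}"

definition isotropy_group ::
    "nat \<Rightarrow> ('k::comm_ring_1 mpoly \<Rightarrow> 'k mpoly) \<Rightarrow> ('k mpoly \<Rightarrow> 'k mpoly) set" where
  "isotropy_group n D = {\<rho> \<in> Aut n. \<forall>p \<in> R n. D (\<rho> p) = \<rho> (D p)}"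

text \<open>
  \<open>tuple n g\<close> is the \<open>k\<close>-algebra endomorphism \<open>(g\<^sub>1, \<dots>, g\<^sub>n)\<close>, that is, the substitution of
  \<open>g\<^sub>i\<close> for \<open>x\<^sub>i\<close>, \<open>1 \<le> i \<le> n\<close>.
\<close>

definition tuple :: "nat \<Rightarrow> (nat \<Rightarrow> 'k::comm_ring_1 mpoly) \<Rightarrow> 'k mpoly \<Rightarrow> 'k mpoly" where
  "tuple n g = restrict (\<lambda>p. \<Sum>s \<in> Poly_Mapping.keys p.
     Const (Poly_Mapping.lookup p s) * (\<Prod>i = 1..n. g i ^ Poly_Mapping.lookup s i)) (R n)"


lemma lookup_pderivative:
  "Poly_Mapping.lookup (pderivative i p) t =
     of_nat (Poly_Mapping.lookup t i + 1) * Poly_Mapping.lookup p (t + Poly_Mapping.single i 1)"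
proof -
  let ?e = "Poly_Mapping.single i (1::nat)"
  have eq: "s = t + ?e" if "s - ?e = t" "Poly_Mapping.lookup s i \<noteq> 0" for s
  proof (rule poly_mapping_eqI)
    fix j
    have "Poly_Mapping.lookup t j = Poly_Mapping.lookup s j - Poly_Mapping.lookup ?e j"
      by (simp only: that(1)[symmetric] lookup_minus)
    then show "Poly_Mapping.lookup s j = Poly_Mapping.lookup (t + ?e) j"
      using that(2) by (cases "j = i") (simp_all add: lookup_add lookup_single when_def)
  qed
  have "Poly_Mapping.lookup (pderivative i p) t = (\<Sum>s \<in> Poly_Mapping.keys p.
      if s = t + ?e then of_nat (Poly_Mapping.lookup s i) * Poly_Mapping.lookup p s else 0)"
    unfolding pderivative_def lookup_sum
  proof (rule sum.cong[OF refl])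
    fix s
    show "Poly_Mapping.lookup (Poly_Mapping.single (s - ?e)
            (of_nat (Poly_Mapping.lookup s i) * Poly_Mapping.lookup p s)) t =
          (if s = t + ?e then of_nat (Poly_Mapping.lookup s i) * Poly_Mapping.lookup p s else 0)"
    proof (cases "Poly_Mapping.lookup s i = 0")
      case False
      then have "s - ?e = t \<longleftrightarrow> s = t + ?e" using eq[of s] by (metis add_diff_cancel_right')
      then show ?thesis by (simp only: lookup_single when_def)
    qed (simp only: of_nat_0 mult_zero_left single_zero lookup_zero if_cancel)
  qed
  also have "\<dots> = of_nat (Poly_Mapping.lookup (t + ?e) i) * Poly_Mapping.lookup p (t + ?e)"
    by (auto simp: in_keys_iff)
  finally show ?thesis by (simp add: lookup_add)
qed

lemma pderivative_add: "pderivative i (p + q) = pderivative i p + pderivative i q"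
  by (rule poly_mapping_eqI) (simp add: lookup_pderivative lookup_add algebra_simps)

lemma pderivative_0 [simp]: "pderivative i 0 = 0"
  by (simp add: pderivative_def)

lemma pderivative_sum: "pderivative i (sum f A) = (\<Sum>x\<in>A. pderivative i (f x))"
  by (induction A rule: infinite_finite_induct) (auto simp: pderivative_add)

lemma pderivative_single:
  "pderivative i (Poly_Mapping.single s a) =
     Poly_Mapping.single (s - Poly_Mapping.single i 1) (of_nat (Poly_Mapping.lookup s i) * a)"
  by (cases "a = 0") (auto simp: pderivative_def)

lemma mpoly_sum_singles:
  fixes p :: "'k::comm_ring_1 mpoly"
  shows "p = (\<Sum>s \<in> Poly_Mapping.keys p. Poly_Mapping.single s (Poly_Mapping.lookup p s))"
  by (rule poly_mapping_eqI) (auto simp: lookup_sum lookup_single when_def in_keys_iff)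

lemma pderivative_mult_single:
  "pderivative i (Poly_Mapping.single s a * Poly_Mapping.single t b) =
     Poly_Mapping.single s a * pderivative i (Poly_Mapping.single t b) +
     pderivative i (Poly_Mapping.single s a) * Poly_Mapping.single t b"
proof -
  let ?e = "Poly_Mapping.single i (1::nat)"
  have move: "u + (v - ?e) = u + v - ?e" if "Poly_Mapping.lookup v i \<noteq> 0" for u v
  proof (rule poly_mapping_eqI)
    fix j
    show "Poly_Mapping.lookup (u + (v - ?e)) j = Poly_Mapping.lookup (u + v - ?e) j"
      using that by (auto simp: lookup_add lookup_minus lookup_single when_def)
  qed
  have 1: "Poly_Mapping.single s a * pderivative i (Poly_Mapping.single t b) =
      Poly_Mapping.single (s + t - ?e) (of_nat (Poly_Mapping.lookup t i) * (a * b))"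
    by (cases "Poly_Mapping.lookup t i = 0")
       (simp_all add: pderivative_single mult_single move[simplified] algebra_simps)
  have 2: "pderivative i (Poly_Mapping.single s a) * Poly_Mapping.single t b =
      Poly_Mapping.single (s + t - ?e) (of_nat (Poly_Mapping.lookup s i) * (a * b))"
    using move[of s t]
    by (cases "Poly_Mapping.lookup s i = 0")
       (simp_all add: pderivative_single mult_single add.commute mult.assoc)
  show ?thesis
    unfolding 1 2 mult_single[of s a t b] pderivative_single[of i "s + t"]
    by (simp only: lookup_add of_nat_add distrib_right single_add add.commute)
qed

lemma pderivative_mult:
  fixes p q :: "'k::comm_ring_1 mpoly"
  shows "pderivative i (p * q) = p * pderivative i q + pderivative i p * q"
proof -
  let ?P = "\<lambda>s. Poly_Mapping.single s (Poly_Mapping.lookup p s)"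
  let ?Q = "\<lambda>s. Poly_Mapping.single s (Poly_Mapping.lookup q s)"
  define A where "A = Poly_Mapping.keys p"
  define B where "B = Poly_Mapping.keys q"
  have p: "p = sum ?P A" and q: "q = sum ?Q B"
    unfolding A_def B_def by (rule mpoly_sum_singles)+
  have "pderivative i (sum ?P A * sum ?Q B) =
      sum ?P A * pderivative i (sum ?Q B) + pderivative i (sum ?P A) * sum ?Q B"
    by (simp only: sum_product pderivative_sum pderivative_mult_single sum.distrib)
  then show ?thesis by (simp only: p[symmetric] q[symmetric])
qed

lemma pderivative_Const [simp]: "pderivative i (Const c) = 0"
  by (simp add: Const_def pderivative_single)

lemma pderivative_Var: "pderivative i (Var j) = (if i = j then 1 else 0)"
  by (auto simp: Var_def pderivative_single lookup_single)

lemma R_add: "p \<in> R n \<Longrightarrow> q \<in> R n \<Longrightarrow> p + q \<in> R n"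
  using Poly_Mapping.keys_add[of p q] by (fastforce simp: R_def)

lemma R_uminus: "p \<in> R n \<Longrightarrow> - p \<in> R n"
  by (simp add: R_def in_keys_iff)

lemma R_diff: "p \<in> R n \<Longrightarrow> q \<in> R n \<Longrightarrow> p - q \<in> R n"
  using R_add[of p n "- q"] by (simp add: R_uminus)

lemma R_mult:
  assumes "p \<in> R n" and "q \<in> R n"
  shows "p * q \<in> R n"
  unfolding R_def
proof (intro CollectI ballI)
  fix u assume "u \<in> Poly_Mapping.keys (p * q)"
  then obtain s t where "s \<in> Poly_Mapping.keys p" "t \<in> Poly_Mapping.keys q" "u = s + t"
    using Poly_Mapping.keys_mult[of p q] by blast
  then show "Poly_Mapping.keys u \<subseteq> {1..n}"
    using assms Poly_Mapping.keys_add[of s t] unfolding R_def by blast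
qed

lemma R_Const: "Const c \<in> R n"
  by (auto simp: R_def Const_def split: if_splits)

lemma R_1: "1 \<in> R n"
  by (simp add: R_def)

lemma R_Var: "i \<in> {1..n} \<Longrightarrow> Var i \<in> R n"
  by (simp add: R_def Var_def)

lemma R_power: "p \<in> R n \<Longrightarrow> p ^ j \<in> R n"
  by (induction j) (auto simp: R_1 R_mult)

lemma R_sum: "(\<And>x. x \<in> A \<Longrightarrow> f x \<in> R n) \<Longrightarrow> sum f A \<in> R n"
  by (induction A rule: infinite_finite_induct) (auto simp: R_add, auto simp: R_def)

lemma R_pderivative: "p \<in> R n \<Longrightarrow> pderivative i p \<in> R n"
proof -
  assume p: "p \<in> R n"
  show ?thesis
    unfolding R_def
  proof (intro CollectI ballI subsetI)
    fix t j
    assume t: "t \<in> Poly_Mapping.keys (pderivative i p)" and j: "j \<in> Poly_Mapping.keys t"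
    have "t + Poly_Mapping.single i 1 \<in> Poly_Mapping.keys p"
      using t by (auto simp: in_keys_iff lookup_pderivative)
    moreover have "j \<in> Poly_Mapping.keys (t + Poly_Mapping.single i 1)"
      using j by (simp add: in_keys_iff lookup_add)
    ultimately show "j \<in> {1..n}" using p unfolding R_def by blast
  qed
qed

lemma k_derivation_d:
  assumes "n \<ge> 2"
  shows "k_derivation n (d m \<alpha> n)"
  unfolding k_derivation_def
proof (intro conjI ballI allI)
  fix p q :: "'a mpoly" and c
  show "d m \<alpha> n (p + q) = d m \<alpha> n p + d m \<alpha> n q"
    by (simp add: d_def pderivative_add distrib_left sum.distrib add_ac)
  show "d m \<alpha> n (Const c * p) = Const c * d m \<alpha> n p"
    by (simp add: d_def pderivative_mult distrib_left sum_distrib_left mult.left_commute)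
  show "d m \<alpha> n (p * q) = p * d m \<alpha> n q + d m \<alpha> n p * q"
    by (simp add: d_def pderivative_mult distrib_left distrib_right sum.distrib
        sum_distrib_left sum_distrib_right mult.left_commute mult.assoc add_ac)
next
  fix p :: "'a mpoly"
  assume "p \<in> R n"
  with assms show "d m \<alpha> n p \<in> R n"
    unfolding d_def
    by (intro R_add R_mult R_diff R_power R_sum R_pderivative R_Var R_1) auto
qed

lemma d_Var_1: "d m \<alpha> n (Var 1) = 1 - Var 1 * Var 2 ^ \<alpha>"
  by (simp add: d_def pderivative_Var)

lemma d_Var_2: "d m \<alpha> n (Var 2) = Var 1 ^ m"
  by (simp add: d_def pderivative_Var)

lemma d_Var: "i \<in> {3..n} \<Longrightarrow> d m \<alpha> n (Var i) = Var (i - 1)"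
  by (auto simp: d_def pderivative_Var if_distrib[of "(*) _"] cong: if_cong)

lemma tuple_Var:
  fixes g :: "nat \<Rightarrow> 'k::comm_ring_1 mpoly"
  assumes "i \<in> {1..n}"
  shows "tuple n g (Var i) = g i"
proof -
  have "(\<Prod>j = 1..n. g j ^ Poly_Mapping.lookup (Poly_Mapping.single i 1) j) =
      (\<Prod>j = 1..n. if j = i then g j else 1)"
    by (intro prod.cong) (auto simp: lookup_single when_def)
  also have "\<dots> = g i" using assms by simp
  finally show ?thesis
    using R_Var[OF assms, where 'a = 'k] by (simp add: tuple_def Var_def Const_def)
qed

lemma tuple_Const: "tuple n g (Const c) = Const c"
  using R_Const[of c n] by (simp add: tuple_def) (auto simp: Const_def)

end

theory Submission
  imports Defs "HOL-Computational_Algebra.Polynomial"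
begin

text \<open>
  Let \<open>\<rho> = (g\<^sub>1, \<dots>, g\<^sub>n)\<close> commute with \<open>d\<close>, so that \<open>d g\<^sub>1 = 1 - g\<^sub>1 g\<^sub>2\<^sup>\<alpha>\<close>, \<open>d g\<^sub>2 = g\<^sub>1\<^sup>m\<close> and
  \<open>d g\<^sub>i = g\<^sub>i\<^sub>-\<^sub>1\<close> for \<open>i \<ge> 3\<close>. For \<open>j \<ge> 3\<close>, the derivation does not raise the degree in \<open>x\<^sub>j\<close> on
  \<open>k[x\<^sub>1, \<dots>, x\<^sub>j]\<close>, and the first two equations force these degrees of \<open>g\<^sub>1\<close> and \<open>g\<^sub>2\<close> to vanish, for
  \<open>j = n, \<dots>, 3\<close> in turn. So \<open>g\<^sub>1, g\<^sub>2 \<in> k[x\<^sub>1, x\<^sub>2]\<close>, where a comparison of degrees and leading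
  coefficients with respect to \<open>x\<^sub>2\<close> gives \<open>g\<^sub>1 = x\<^sub>1\<close> and \<open>g\<^sub>2 = x\<^sub>2\<close>.

  If \<open>d F = a x\<^sub>n + b\<close> with constants \<open>a, b\<close>, then \<open>a = b = 0\<close> and \<open>F\<close> is constant: this passes from \<open>n\<close>
  to \<open>n + 1\<close> by comparing the two top coefficients with respect to \<open>x\<^sub>n\<^sub>+\<^sub>1\<close>, and the case \<open>n = 2\<close> is a
  weight argument. Applied to \<open>d (g\<^sub>i - x\<^sub>i) = g\<^sub>i\<^sub>-\<^sub>1 - x\<^sub>i\<^sub>-\<^sub>1\<close>, it shows successively that
  \<open>g\<^sub>i - x\<^sub>i\<close> is a constant, which is zero for \<open>i < n\<close>.
\<close>

section \<open>The derivation in two variables\<close>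

text \<open>The Leibniz rule passes to the convolution sums for coefficients of a product. It serves
  the coefficientwise parts of \<open>dxy\<close> and \<open>d_poly\<close>.\<close>

lemma leibniz_map_poly:
  fixes \<delta> :: "'a::comm_ring_1 \<Rightarrow> 'a"
  assumes add: "\<And>a b. \<delta> (a + b) = \<delta> a + \<delta> b"
    and mult: "\<And>a b. \<delta> (a * b) = a * \<delta> b + \<delta> a * b"
  shows "map_poly \<delta> (p * q) = p * map_poly \<delta> q + map_poly \<delta> p * q"
proof (rule poly_eqI)
  fix i
  have 0: "\<delta> 0 = 0" using add[of 0 0] by simp
  have sum: "\<delta> (sum f A) = (\<Sum>x\<in>A. \<delta> (f x))" for f :: "nat \<Rightarrow> 'a" and A
    by (induction A rule: infinite_finite_induct) (auto simp: 0 add)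
  show "coeff (map_poly \<delta> (p * q)) i = coeff (p * map_poly \<delta> q + map_poly \<delta> p * q) i"
    by (simp add: coeff_map_poly 0 coeff_mult sum mult sum.distrib)
qed

text \<open>In \<open>'k poly poly\<close>, the inner variable is \<open>x = x\<^sub>1\<close> and the outer one is \<open>y = x\<^sub>2\<close>.\<close>

definition dxy :: "nat \<Rightarrow> nat \<Rightarrow> 'k::field_char_0 poly poly \<Rightarrow> 'k poly poly" where
  "dxy m \<alpha> P = (1 - monom (monom 1 1) \<alpha>) * map_poly pderiv P + [:monom 1 m:] * pderiv P"

lemma dxy_add: "dxy m \<alpha> (P + Q) = dxy m \<alpha> P + dxy m \<alpha> Q"
proof -
  have "map_poly pderiv (P + Q) = map_poly pderiv P + map_poly pderiv Q"
    by (rule poly_eqI) (simp add: coeff_map_poly pderiv_add)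
  then show ?thesis by (simp add: dxy_def pderiv_add algebra_simps smult_add_right)
qed

lemma dxy_mult: "dxy m \<alpha> (P * Q) = P * dxy m \<alpha> Q + dxy m \<alpha> P * Q"
proof -
  have "map_poly pderiv (P * Q) = P * map_poly pderiv Q + map_poly pderiv P * Q"
    by (rule leibniz_map_poly) (simp_all add: pderiv_add pderiv_mult algebra_simps)
  then show ?thesis by (simp add: dxy_def pderiv_mult algebra_simps del: mult_pCons_left)
qed

lemma coeff_dxy:
  "coeff (dxy m \<alpha> P) j = pderiv (coeff P j)
     - (if j < \<alpha> then 0 else monom 1 1 * pderiv (coeff P (j - \<alpha>)))
     + of_nat (Suc j) * (monom 1 m * coeff P (Suc j))"
  by (simp add: dxy_def coeff_map_poly coeff_pderiv left_diff_distrib coeff_monom_mult)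

lemma coeff_of_nat_mult: "coeff (of_nat n * p) i = of_nat n * coeff (p :: 'k::comm_ring_1 poly) i"
  by (simp add: of_nat_poly)

text \<open>If x^l y^j has weight (\<alpha> + 1) l + m j, the last two coefficients belong to
  monomials of equal weight; the weight of the first exceeds it by \<alpha> + 1 + m
  \<alpha>.\<close>

lemma coeff_coeff_dxy:
  "coeff (coeff (dxy m \<alpha> P) j) l = of_nat (Suc l) * coeff (coeff P j) (Suc l)
     - (if j < \<alpha> then 0 else of_nat l * coeff (coeff P (j - \<alpha>)) l)
     + (if l < m then 0 else of_nat (Suc j) * coeff (coeff P (Suc j)) (l - m))"
  unfolding coeff_dxy
  by (cases l) (auto simp: coeff_of_nat_mult coeff_monom_mult coeff_pderiv simp del: of_nat_Suc)

section \<open>Polynomials in x and y whose derivative is free of x\<close>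

text \<open>The field carries no order; positive rational multiples of one nonzero element replace
  positive numbers, as sums of them cannot cancel.\<close>

definition pos_multiples :: "'k::field_char_0 \<Rightarrow> 'k set" where
  "pos_multiples c = {of_rat q * c | q. q > 0}"

lemma pos_multiples_self: "c \<in> pos_multiples c"
  unfolding pos_multiples_def by (rule CollectI, rule exI[of _ 1]) simp

lemma pos_multiples_add: "a \<in> pos_multiples c \<Longrightarrow> b \<in> pos_multiples c \<Longrightarrow> a + b \<in> pos_multiples c"
  unfolding pos_multiples_def by clarify (metis add_pos_pos distrib_right of_rat_add)

lemma pos_multiples_of_nat_mult:
  assumes "a \<in> pos_multiples c" "n > 0"
  shows "of_nat n * a \<in> pos_multiples c"
proof -
  from assms obtain q where "q > 0" "a = of_rat q * c" by (auto simp: pos_multiples_def)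
  with assms(2) show ?thesis unfolding pos_multiples_def
    by (intro CollectI exI[of _ "of_nat n * q"]) (simp add: of_rat_mult)
qed

lemma pos_multiples_of_nat_cancel:
  assumes "of_nat n * a \<in> pos_multiples c" "n > 0"
  shows "a \<in> pos_multiples c"
proof -
  from assms obtain q where "q > 0" "of_nat n * a = of_rat q * c" by (auto simp: pos_multiples_def)
  with assms(2) show ?thesis unfolding pos_multiples_def
    by (intro CollectI exI[of _ "q / of_nat n"]) (simp add: of_rat_divide field_simps)
qed

lemma zero_notin_pos_multiples: "c \<noteq> 0 \<Longrightarrow> 0 \<notin> pos_multiples c"
  by (auto simp: pos_multiples_def)

text \<open>
  Give \<open>x\<close> the weight \<open>\<alpha> + 1\<close> and \<open>y\<close> the weight \<open>m\<close>. The part of \<open>F\<close> of top weight is killed by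
  \<open>x\<^sup>m \<partial>\<^sub>y - x y\<^sup>\<alpha> \<partial>\<^sub>x\<close>, so it is a multiple of a power of \<open>x\<^sup>m / m + y\<^sup>\<alpha>\<^sup>+\<^sup>1 / (\<alpha> + 1)\<close>. Then \<open>\<partial>\<^sub>x\<close> of this
  part has to be cancelled by terms with \<open>x\<close>-exponent \<open>-1\<close> modulo \<open>m\<close>. All these coefficients are positive
  rational multiples of that of \<open>y\<^sup>r\<close>, which the coefficient of \<open>x\<^sup>m\<^sup>q\<^sup>-\<^sup>1\<close> in the equation contradicts.
\<close>

lemma constant_if_dxy_free_of_x:
  fixes F :: "'k::field_char_0 poly poly"
  assumes m: "m \<ge> 2" and \<alpha>: "\<alpha> \<ge> 1"
    and F: "\<And>j l. l \<ge> 1 \<Longrightarrow> coeff (coeff (dxy m \<alpha> F) j) l = 0"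
  shows "\<exists>c. F = [:[:c:]:]"
proof -
  define c where "c l j = coeff (coeff F j) l" for l j
  define wt where "wt l j = (\<alpha> + 1) * l + m * j" for l j :: nat
  have E: "of_nat (Suc l) * c (Suc l) j - (if j < \<alpha> then 0 else of_nat l * c l (j - \<alpha>))
     + (if l < m then 0 else of_nat (Suc j) * c (l - m) (Suc j)) = 0" if "l \<ge> 1" for l j
    using F[OF that, of j] unfolding coeff_coeff_dxy c_def .
  define S where "S = {(l, j). c l j \<noteq> 0}"
  have "S \<subseteq> (SIGMA l : {..Max ((\<lambda>j. degree (coeff F j)) ` {..degree F})}. {..degree F})"
  proof safe
    fix l j assume "(l, j) \<in> S"
    then have "coeff (coeff F j) l \<noteq> 0" by (simp add: S_def c_def)
    then have "j \<le> degree F" "l \<le> degree (coeff F j)"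
      by (auto intro!: le_degree)
    moreover from this have "degree (coeff F j) \<le> Max ((\<lambda>j. degree (coeff F j)) ` {..degree F})"
      by (intro Max_ge) auto
    ultimately show "l \<le> Max ((\<lambda>j. degree (coeff F j)) ` {..degree F})" "j \<le> degree F"
      by linarith+
  qed
  then have finS: "finite S" by (rule finite_subset) auto
  \<comment> \<open>Inserting 0 covers F = 0. Once w = 0, only \<open>c 0 0\<close> survives, since
    every other exponent pair has positive weight.\<close>
  define w where "w = Max (insert 0 ((\<lambda>(l, j). wt l j) ` S))"
  have above: "c l j = 0" if "wt l j > w" for l j
  proof (rule ccontr)
    assume "c l j \<noteq> 0"
    then have "wt l j \<in> insert 0 ((\<lambda>(l, j). wt l j) ` S)" by (force simp: S_def)
    then have "wt l j \<le> w" unfolding w_def using finS by (intro Max_ge) auto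
    with that show False by simp
  qed
  have "w = 0"
  proof (rule ccontr)
    assume w: "w \<noteq> 0"
    have "w \<in> insert 0 ((\<lambda>(l, j). wt l j) ` S)" unfolding w_def using finS by (intro Max_in) auto
    with w have ex: "\<exists>l j. c l j \<noteq> 0 \<and> wt l j = w" by (auto simp: S_def)
    \<comment> \<open>Coefficient of x^l y^(j + \<alpha>): the term with
      \<open>c (Suc l) (j + \<alpha>)\<close> lies above the top weight, so the other two
      cancel.\<close>
    have top: "of_nat l * c l j = (if l < m then 0 else of_nat (j + \<alpha> + 1) * c (l - m) (j + \<alpha> + 1))"
      if "wt l j = w" "l \<ge> 1" for l j
    proof -
      have "wt (Suc l) (j + \<alpha>) > w" using that by (simp add: wt_def algebra_simps)
      then have "c (Suc l) (j + \<alpha>) = 0" by (rule above)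
      then show ?thesis using E[OF that(2), of "j + \<alpha>"]
        by (simp add: add.commute[of "- _"] split: if_splits)
    qed
    \<comment> \<open>Coefficient of x^(l + m) y^j with j < \<alpha>: the shifted term is absent,
      and the first term lies above the top weight.\<close>
    have bottom: "c l (Suc j) = 0" if "wt l (Suc j) = w" "Suc j \<le> \<alpha>" for l j
    proof -
      have "wt (Suc (l + m)) j > w" using that m by (simp add: wt_def algebra_simps) 
      then have "of_nat (Suc j) * c l (Suc j) = 0"
        using E[of "l + m" j] m that(2) above by (auto simp del: of_nat_Suc)
      then show ?thesis by (simp del: of_nat_Suc)
    qed
    \<comment> \<open>\<open>top\<close> carries a nonzero coefficient at x-exponent L \<ge> 1 to L
      - m. Hence the least exponent is 0, and the top part contains a pure power y^r.\<close>
    define L where "L = (LEAST l. \<exists>j. c l j \<noteq> 0 \<and> wt l j = w)"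
    have "\<exists>j. c L j \<noteq> 0 \<and> wt L j = w" unfolding L_def by (rule LeastI_ex) (fact ex)
    then obtain r where r: "c L r \<noteq> 0" "wt L r = w" by blast
    have "L = 0"
    proof (rule ccontr)
      assume "L \<noteq> 0"
      then have L: "L \<ge> 1" by simp
      have "of_nat L * c L r \<noteq> 0" using r L by simp
      with top[OF r(2) L] have Lm: "L \<ge> m" and "c (L - m) (r + \<alpha> + 1) \<noteq> 0" by (auto split: if_splits)
      moreover have "wt (L - m) (r + \<alpha> + 1) = w"
        using r(2) Lm by (auto simp: wt_def algebra_simps le_iff_add)
      ultimately have "L \<le> L - m" unfolding L_def by (intro Least_le) auto
      with L m show False by simp
    qed
    with r have r0: "c 0 r \<noteq> 0" and w_r: "w = m * r" by (auto simp: wt_def)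
    let ?P = "pos_multiples (c 0 r)"
    \<comment> \<open>Starting at y^r, \<open>top\<close> moves along the line of weight w; both of
      its factors are positive integers.\<close>
    have lev1: "c (m * s) j \<in> ?P" if "j + (\<alpha> + 1) * s = r" for s j
      using that
    proof (induction s arbitrary: j)
      case 0
      then show ?case by (simp add: pos_multiples_self)
    next
      case (Suc s)
      have "c (m * s) (j + \<alpha> + 1) \<in> ?P" using Suc.prems by (intro Suc.IH) simp
      then have P: "of_nat (j + \<alpha> + 1) * c (m * s) (j + \<alpha> + 1) \<in> ?P"
        by (rule pos_multiples_of_nat_mult) simp
      have "wt (m * Suc s) j = w" using Suc.prems by (auto simp: wt_def w_r algebra_simps)
      moreover have "m * Suc s \<ge> 1" "\<not> m * Suc s < m" "m * Suc s - m = m * s" using m by auto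
      ultimately have "of_nat (m * Suc s) * c (m * Suc s) j
          = of_nat (j + \<alpha> + 1) * c (m * s) (j + \<alpha> + 1)"
        using top[of "m * Suc s" j] by (simp only: if_False)
      with P have "of_nat (m * Suc s) * c (m * Suc s) j \<in> ?P" by (simp only:)
      then show ?case by (rule pos_multiples_of_nat_cancel) (use m in simp)
    qed
    \<comment> \<open>Unless \<alpha> + 1 divides r, this walk ends at a y-exponent between 1 and
      \<alpha>, where \<open>bottom\<close> makes the coefficient zero.\<close>
    define q where "q = r div (\<alpha> + 1)"
    have rq: "r mod (\<alpha> + 1) + (\<alpha> + 1) * q = r" unfolding q_def by (rule mod_mult_div_eq)
    have "r mod (\<alpha> + 1) = 0"
    proof (rule ccontr)
      assume "r mod (\<alpha> + 1) \<noteq> 0"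
      then obtain j where j: "r mod (\<alpha> + 1) = Suc j" by (cases "r mod (\<alpha> + 1)") auto
      have "r mod (\<alpha> + 1) < \<alpha> + 1" by simp
      with j have "Suc j \<le> \<alpha>" by simp
      moreover have "wt (m * q) (Suc j) = m * (Suc j + (\<alpha> + 1) * q)"
        by (simp add: wt_def algebra_simps)
      then have "wt (m * q) (Suc j) = w" using rq by (simp only: j w_r)
      ultimately have "c (m * q) (Suc j) = 0" by (intro bottom)
      with lev1[OF rq] zero_notin_pos_multiples[OF r0] show False by (simp only: j)
    qed
    then have rq: "(\<alpha> + 1) * q = r" using rq by (simp only: add_0_left)
    with w w_r obtain q' where q': "q = Suc q'" by (cases q) auto
    \<comment> \<open>The next line of monomials, at weight w - (\<alpha> + 1) - m \<alpha>. The
      x-derivative of the top part and the preceding coefficient on this line enter with the same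
      sign.\<close>
    have lev2: "c (m * Suc s - 1) j \<in> ?P" if "j + (\<alpha> + 1) * Suc s + \<alpha> = r" for s j
      using that
    proof (induction s arbitrary: j)
      case 0
      have "c (m * 1) (j + \<alpha>) \<in> ?P" using 0 by (intro lev1) simp
      then have P: "of_nat m * c m (j + \<alpha>) \<in> ?P"
        using m by (intro pos_multiples_of_nat_mult) auto
      have "of_nat (m - 1) * c (m - 1) j = of_nat m * c m (j + \<alpha>)"
        using E[of "m - 1" "j + \<alpha>"] m by simp
      with P have "of_nat (m - 1) * c (m * Suc 0 - 1) j \<in> ?P"
        by (simp only: mult_Suc_right mult_0_right add_0_right)
      then show ?case by (rule pos_multiples_of_nat_cancel) (use m in simp)
    next
      case (Suc s)
      have "c (m * Suc (Suc s)) (j + \<alpha>) \<in> ?P" using Suc.prems by (intro lev1) simp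
      then have 1: "of_nat (m * Suc (Suc s)) * c (m * Suc (Suc s)) (j + \<alpha>) \<in> ?P"
        using m by (intro pos_multiples_of_nat_mult) auto
      have "c (m * Suc s - 1) (Suc (j + \<alpha>)) \<in> ?P" using Suc.prems by (intro Suc.IH) simp
      then have 2: "of_nat (Suc (j + \<alpha>)) * c (m * Suc s - 1) (Suc (j + \<alpha>)) \<in> ?P"
        by (intro pos_multiples_of_nat_mult) auto
      define l where "l = m * Suc (Suc s) - 1"
      have l: "l \<ge> 1" "\<not> l < m" "Suc l = m * Suc (Suc s)" "l - m = m * Suc s - 1"
        using m by (auto simp: l_def)
      have "of_nat l * c l j = of_nat (Suc l) * c (Suc l) (j + \<alpha>)
          + of_nat (Suc (j + \<alpha>)) * c (l - m) (Suc (j + \<alpha>))"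
        using E[OF l(1), of "j + \<alpha>"] l(2)
        by (simp add: diff_add_eq eq_commute[of "of_nat l * _"] del: of_nat_Suc)
      also have "\<dots> \<in> ?P" unfolding l(3,4) by (rule pos_multiples_add[OF 1 2])
      finally show ?case unfolding l_def[symmetric]
        by (rule pos_multiples_of_nat_cancel) (use l(1) in simp)
    qed
    \<comment> \<open>Coefficient of x^(m q - 1) y^0: the shifted term is missing since 0 <
      \<alpha>, so positive multiples would add up to zero. For q = 1 only one of them is
      left.\<close>
    have 1: "of_nat (m * q) * c (m * q) 0 \<in> ?P"
      using lev1[of 0 q] rq m q' by (intro pos_multiples_of_nat_mult) auto
    have mq: "m * q - 1 \<ge> 1" "Suc (m * q - 1) = m * q" using m q' by (auto simp: )
    have "0 < \<alpha>" using \<alpha> by simp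
    then have E0: "of_nat (m * q) * c (m * q) 0
        + (if m * q - 1 < m then 0 else of_nat (Suc 0) * c (m * q - 1 - m) (Suc 0)) = 0"
      using E[OF mq(1), of 0] unfolding mq(2) by (simp only: if_True diff_zero)
    show False
    proof (cases q')
      case 0
      then have "m * q - 1 < m" using q' m by simp
      with E0 have "of_nat (m * q) * c (m * q) 0 = 0" by (simp only: if_True add_0_right)
      with 1 zero_notin_pos_multiples[OF r0] show False by (simp only:)
    next
      case (Suc s)
      have "c (m * Suc s - 1) (Suc 0) \<in> ?P" using rq q' Suc by (intro lev2) simp
      then have "of_nat (Suc 0) * c (m * Suc s - 1) (Suc 0) \<in> ?P"
        by (rule pos_multiples_of_nat_mult) simp
      with 1 have "of_nat (m * q) * c (m * q) 0 + of_nat (Suc 0) * c (m * Suc s - 1) (Suc 0) \<in> ?P"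
        by (rule pos_multiples_add)
      moreover have "\<not> m * q - 1 < m" "m * q - 1 - m = m * Suc s - 1" using q' Suc m by auto
      ultimately have "0 \<in> ?P" using E0 by (simp only: if_False)
      with zero_notin_pos_multiples[OF r0] show False by blast
    qed
  qed
  have "F = [:[:c 0 0:]:]"
  proof (intro poly_eqI)
    fix j l
    show "coeff (coeff F j) l = coeff (coeff [:[:c 0 0:]:] j) l"
      using above[of l j] \<open>w = 0\<close> m by (cases j; cases l) (auto simp: c_def wt_def)
  qed
  then show ?thesis by blast
qed

text \<open>The right-hand side is free of x, so F is constant and its derivative zero. This starts
  the induction in \<open>d_eq_affine_last_var\<close>.\<close>

lemma dxy_eq_affine_y:
  fixes F :: "'k::field_char_0 poly poly"
  assumes "m \<ge> 2" and "\<alpha> \<ge> 1" and F: "dxy m \<alpha> F = [:[:b:], [:a:]:]"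
  shows "a = 0 \<and> b = 0 \<and> (\<exists>c. F = [:[:c:]:])"
proof -
  have "coeff (coeff (dxy m \<alpha> F) j) l = 0" if "l \<ge> 1" for j l
    using that unfolding F by (auto simp: coeff_pCons split: nat.splits)
  from constant_if_dxy_free_of_x[OF assms(1,2) this] obtain c where c: "F = [:[:c:]:]" by blast
  then have "dxy m \<alpha> F = 0" by (simp add: dxy_def pderiv_pCons map_poly_pCons)
  with F c show ?thesis by auto
qed

section \<open>Pairs in k[x][y] satisfying the differential equations of x and y\<close>

text \<open>
  If \<open>h\<^sub>0(0) \<noteq> 0\<close>, the right-hand side vanishes to order exactly one at \<open>0\<close>; otherwise, its
  degree is congruent to one modulo \<open>m\<close>.
\<close>

lemma power_eq_X_times_diff_powers:
  fixes h h\<^sub>0 :: "'k::idom poly"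
  assumes m: "m \<ge> 2" and eq: "h ^ m = monom 1 1 * (monom c m - h\<^sub>0 ^ m)"
  shows "h = 0"
proof (rule ccontr)
  assume h: "h \<noteq> 0"
  let ?X = "monom 1 1 :: 'k poly"
  have X_dvd: "?X dvd p \<longleftrightarrow> poly p 0 = 0" for p :: "'k poly"
    using poly_eq_0_iff_dvd[of p 0] by (simp add: monom_altdef)
  have "poly (h ^ m) 0 = 0" unfolding eq by (simp add: poly_monom)
  with m have "poly h 0 = 0" by simp
  then obtain u where u: "h = ?X * u" using X_dvd[of h] by blast
  obtain m' where m': "m = Suc (Suc m')" using m by (metis add_2_eq_Suc le_Suc_ex)
  have "monom c m - h\<^sub>0 ^ m = ?X * (?X ^ m' * u ^ m)"
  proof -
    have "?X * (monom c m - h\<^sub>0 ^ m) = ?X * (?X * (?X ^ m' * u ^ m))"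
      unfolding eq[symmetric] u power_mult_distrib by (simp add: m' mult_ac)
    then show ?thesis by (simp del: mult_cancel_left add: mult_left_cancel)
  qed
  then have "poly (monom c m - h\<^sub>0 ^ m) 0 = 0" by (simp add: poly_monom)
  with m have "poly h\<^sub>0 0 = 0" by (simp add: poly_monom zero_power)
  then obtain k where k: "h\<^sub>0 = ?X * k" using X_dvd[of h\<^sub>0] by blast
  have mc: "monom c m = [:c:] * ?X ^ m" by (simp add: monom_power smult_monom)
  have "monom 1 (Suc m) = ?X * ?X ^ m" by (simp add: monom_power mult_monom)
  then have eq': "h ^ m = monom 1 (Suc m) * ([:c:] - k ^ m)"
    unfolding eq k power_mult_distrib mc by (simp only: right_diff_distrib mult_ac)
  have W: "[:c:] - k ^ m \<noteq> 0" using h eq' by auto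
  have "m dvd degree ([:c:] - k ^ m)"
  proof (cases "degree k = 0")
    case True
    then have "degree ([:c:] - k ^ m) = 0"
      by (metis degree_0 degree_diff_le degree_pCons_0 degree_power_le le_zero_eq mult_zero_left)
    then show ?thesis by simp
  next
    case False
    then have "degree (k ^ m) = m * degree k" by (intro degree_power_eq) auto
    moreover have "degree ([:c:] - k ^ m) = degree (k ^ m)"
      using False m \<open>degree (k ^ m) = _\<close> degree_add_eq_right[of "[:c:]" "- (k ^ m)"] by simp
    ultimately show ?thesis by simp
  qed
  moreover have "m * degree h = Suc m + degree ([:c:] - k ^ m)"
    using arg_cong[OF eq', of degree] W h by (simp add: degree_power_eq degree_mult_eq degree_monom_eq)
  then have "m dvd Suc m + degree ([:c:] - k ^ m)" by (metis dvd_triv_left)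
  ultimately have "m dvd Suc m" by (simp only: dvd_add_left_iff)
  then have "m dvd 1" by (metis dvd_add_right_iff dvd_refl plus_1_eq_Suc add.commute)
  with m show False by simp
qed

lemma coeff_X_mult_pderiv: "coeff (monom 1 1 * pderiv p) l = of_nat l * coeff p l"
  by (cases l) (simp_all add: coeff_monom_mult coeff_pderiv)

lemma degree_X_mult_pderiv_le: "degree (monom 1 1 * pderiv p) \<le> degree p"
  by (rule degree_le) (simp add: coeff_X_mult_pderiv[unfolded One_nat_def] coeff_eq_0)

lemma degree_dxy_le: "degree (dxy m \<alpha> P) \<le> degree P + \<alpha>"
  by (rule degree_le) (auto simp: coeff_dxy coeff_eq_0)

text \<open>
  The degree in \<open>y\<close> of the hypothesis bounds that of \<open>B\<close> by \<open>1\<close>. For \<open>B = p + q y\<close> and \<open>h\<close> the leading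
  coefficient of \<open>A\<close>, its top coefficient is \<open>x h' = h q\<^sup>\<alpha>\<close>, so that \<open>q\<close> is constant.
\<close>

lemma dxy_commuting_pair_degree:
  fixes A B :: "'k::field_char_0 poly poly"
  assumes \<alpha>: "\<alpha> \<ge> 1" and A: "dxy m \<alpha> A = 1 - A * B ^ \<alpha>" and A0: "A \<noteq> 0"
  shows "\<exists>p c. B = [:p, [:c:]:]"
proof (cases "degree B = 0")
  case True
  then obtain p where "B = [:p:]" by (rule degree_eq_zeroE)
  then have "B = [:p, [:0:]:]" by simp
  then show ?thesis by blast
next
  case False
  then have B0: "B \<noteq> 0" by auto
  have deg: "degree (A * B ^ \<alpha>) = degree A + \<alpha> * degree B"
    using A0 B0 by (simp add: degree_mult_eq degree_power_eq)
  have "degree (A * B ^ \<alpha>) = degree (1 - dxy m \<alpha> A)" by (simp add: A)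
  also have "\<dots> \<le> degree A + \<alpha>" by (rule degree_diff_le) (simp_all add: degree_dxy_le)
  finally have "degree B \<le> 1" using deg \<alpha> by simp
  with False have B1: "degree B = 1" by simp
  let ?h = "lead_coeff A" and ?q = "coeff B 1"
  have "coeff (A * B ^ \<alpha>) (degree A + \<alpha>) = ?h * ?q ^ \<alpha>"
    using lead_coeff_mult[of A "B ^ \<alpha>"] deg B1 by (simp add: lead_coeff_power)
  moreover have "coeff (dxy m \<alpha> A) (degree A + \<alpha>) = - (monom 1 1 * pderiv ?h)"
    using \<alpha> by (simp add: coeff_dxy coeff_eq_0)
  ultimately have "monom 1 1 * pderiv ?h = ?h * ?q ^ \<alpha>"
    using arg_cong[OF A, of "\<lambda>P. coeff P (degree A + \<alpha>)"] \<alpha> by simp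
  then have "degree (?h * ?q ^ \<alpha>) \<le> degree ?h" by (metis degree_X_mult_pderiv_le)
  moreover have "?q \<noteq> 0" using B1 B0 by (metis leading_coeff_0_iff)
  ultimately have "degree ?q = 0"
    using A0 \<alpha> by (simp add: degree_mult_eq degree_power_eq)
  then obtain c where "?q = [:c:]" by (rule degree_eq_zeroE)
  with B1 have "B = [:coeff B 0, [:c:]:]"
    by (intro poly_eqI) (auto simp: coeff_pCons coeff_eq_0 split: nat.splits)
  then show ?thesis by blast
qed

text \<open>With B = p + c y, the second equation is A^m = p' + c x^m - x p' y^\<alpha>. If p' were
  nonzero, the constant and leading coefficients h0, h of A in y would satisfy h^m = x (c x^m -
  h0^m). So p is a constant p0 and A = h(x); the first equation gives h' = 1 - h p0^\<alpha> and x
  h' = c^\<alpha> h, whence h = x and p0 = 0. Finally h^m = c x^m gives c = 1.\<close>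

lemma dxy_commuting_pair:
  fixes A B :: "'k::field_char_0 poly poly"
  assumes m: "m \<ge> 2" and \<alpha>: "\<alpha> \<ge> 1"
    and A: "dxy m \<alpha> A = 1 - A * B ^ \<alpha>" and B: "dxy m \<alpha> B = A ^ m"
  shows "A = [:[:0, 1:]:] \<and> B = [:0, 1:]"
proof -
  have A0: "A \<noteq> 0"
  proof
    assume "A = 0"
    with A have "dxy m \<alpha> 0 = (1 :: 'k poly poly)" by simp
    then show False by (simp add: dxy_def)
  qed
  obtain p c where B_eq: "B = [:p, [:c:]:]" using dxy_commuting_pair_degree[OF \<alpha> A A0] by blast
  have "dxy m \<alpha> B = [:pderiv p + monom c m:] - monom (monom 1 1 * pderiv p) \<alpha>"
    using \<alpha> by (intro poly_eqI)
      (auto simp: B_eq coeff_dxy coeff_pCons pderiv_pCons smult_monom mult.commute[of _ "[:_:]"]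
        split: nat.splits)
  with B have Am: "A ^ m = [:pderiv p + monom c m:] - monom (monom 1 1 * pderiv p) \<alpha>" by simp
  have p': "pderiv p = 0"
  proof (rule ccontr)
    assume p': "pderiv p \<noteq> 0"
    have neq: "monom (monom 1 1 * pderiv p) \<alpha> \<noteq> 0" using p' by simp
    have "coeff (A ^ m) 0 = pderiv p + monom c m" unfolding Am using \<alpha> by simp
    then have h0: "coeff A 0 ^ m = pderiv p + monom c m" by (simp only: coeff_0_power)
    have deg: "degree (A ^ m) = \<alpha>"
    proof -
      have "degree (- monom (monom 1 1 * pderiv p) \<alpha>) = \<alpha>"
        unfolding degree_minus using p' by (intro degree_monom_eq) simp
      then show ?thesis unfolding Am using \<alpha>
        degree_add_eq_right[of "[:pderiv p + monom c m:]" "- monom (monom 1 1 * pderiv p) \<alpha>"]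
        by simp
    qed
    have "lead_coeff A ^ m = coeff (A ^ m) \<alpha>" using deg by (simp add: lead_coeff_power[symmetric])
    also have "\<dots> = - (monom 1 1 * pderiv p)" unfolding Am using \<alpha>
      by (auto simp: coeff_pCons split: nat.splits)
    also have "\<dots> = monom 1 1 * (monom c m - coeff A 0 ^ m)" unfolding h0 by simp
    finally have "lead_coeff A = 0" by (rule power_eq_X_times_diff_powers[OF m])
    with A0 show False by simp
  qed
  then obtain p0 where p: "p = [:p0:]" by (auto simp: pderiv_eq_0_iff elim: degree_eq_zeroE)
  have Am: "A ^ m = [:monom c m:]" using Am p' by simp
  have "m * degree A = 0" using arg_cong[OF Am, of degree] A0 by (simp add: degree_power_eq)
  with m have "degree A = 0" by simp
  then obtain h where h: "A = [:h:]" by (rule degree_eq_zeroE)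
  have h0: "h \<noteq> 0" using A0 h by simp
  have hm: "h ^ m = monom c m" using Am coeff_0_power[of A m] by (simp add: h)
  have hB: "coeff (A * B ^ \<alpha>) i = h * coeff (B ^ \<alpha>) i" for i by (simp add: h)
  have "coeff (B ^ \<alpha>) 0 = [:p0 ^ \<alpha>:]" by (simp add: coeff_0_power B_eq p poly_const_pow)
  then have e0: "pderiv h = 1 - h * [:p0 ^ \<alpha>:]"
    using arg_cong[OF A, of "\<lambda>P. coeff P 0"] \<alpha> unfolding coeff_diff hB
    by (simp add: coeff_dxy h)
  have "coeff (B ^ \<alpha>) \<alpha> = [:c ^ \<alpha>:]"
  proof (cases "c = 0")
    case True
    then show ?thesis using \<alpha> by (auto simp: B_eq poly_const_pow coeff_pCons split: nat.splits)
  next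
    case False
    then have "degree (B ^ \<alpha>) = \<alpha>" "lead_coeff B = [:c:]"
      by (simp_all add: B_eq degree_power_eq)
    then show ?thesis using lead_coeff_power[of B \<alpha>] by (simp add: poly_const_pow)
  qed
  then have e\<alpha>: "monom 1 1 * pderiv h = h * [:c ^ \<alpha>:]"
    using arg_cong[OF A, of "\<lambda>P. coeff P \<alpha>"] \<alpha> unfolding coeff_diff hB
    by (auto simp: coeff_dxy h coeff_pCons split: nat.splits)
  have "c \<noteq> 0" using hm h0 by auto
  have "pderiv h \<noteq> 0" using e\<alpha> h0 \<open>c \<noteq> 0\<close> by auto
  then have deg_h: "degree h \<noteq> 0" by (simp add: pderiv_eq_0_iff)
  have "p0 ^ \<alpha> = 0"
  proof (rule ccontr)
    assume "p0 ^ \<alpha> \<noteq> 0"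
    then have "degree (h * [:p0 ^ \<alpha>:]) = degree h" using h0 by (subst degree_mult_eq) auto
    moreover have "h * [:p0 ^ \<alpha>:] = 1 - pderiv h" using e0 by simp
    moreover have "degree (1 - pderiv h) \<le> degree h - 1"
      by (rule degree_diff_le) (simp_all add: degree_pderiv)
    ultimately have "degree h \<le> degree h - 1" by (simp only:)
    with deg_h show False by simp
  qed
  with e0 have h': "pderiv h = 1" by simp
  have "degree h - 1 = degree (pderiv h)" by (simp add: degree_pderiv)
  with h' deg_h have "degree h = 1" by simp
  have "h * [:c ^ \<alpha>:] = monom 1 1" using e\<alpha> h' by simp
  then have "coeff (h * [:c ^ \<alpha>:]) 0 = 0" "coeff (h * [:c ^ \<alpha>:]) 1 = 1" by simp_all
  then have "coeff h 0 = 0" using \<open>c \<noteq> 0\<close> by simp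
  moreover have "coeff h 1 = 1" using arg_cong[OF h', of "\<lambda>p. coeff p 0"] by (simp add: coeff_pderiv)
  ultimately have hX: "h = [:0, 1:]" using \<open>degree h = 1\<close>
    by (intro poly_eqI) (auto simp: coeff_pCons coeff_eq_0 split: nat.splits)
  have "coeff (h ^ m) m = 1" unfolding hX by (rule coeff_linear_power)
  with hm have "c = 1" by simp
  with \<open>p0 ^ \<alpha> = 0\<close> show ?thesis by (simp add: h hX B_eq p)
qed

section \<open>Homomorphisms out of polynomial rings\<close>

lemma sum_keys_add:
  fixes f :: "'a \<Rightarrow> 'b::comm_monoid_add \<Rightarrow> 'c::comm_monoid_add"
  assumes f0: "\<And>s. f s 0 = 0" and add: "\<And>s a b. f s (a + b) = f s a + f s b"
  shows "(\<Sum>s\<in>Poly_Mapping.keys (p + q). f s (Poly_Mapping.lookup (p + q) s))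
    = (\<Sum>s\<in>Poly_Mapping.keys p. f s (Poly_Mapping.lookup p s))
      + (\<Sum>s\<in>Poly_Mapping.keys q. f s (Poly_Mapping.lookup q s))"
proof -
  have *: "(\<Sum>s\<in>Poly_Mapping.keys r. f s (Poly_Mapping.lookup r s))
      = (\<Sum>s\<in>Poly_Mapping.keys p \<union> Poly_Mapping.keys q. f s (Poly_Mapping.lookup r s))"
    if "Poly_Mapping.keys r \<subseteq> Poly_Mapping.keys p \<union> Poly_Mapping.keys q" for r
    using that f0 by (intro sum.mono_neutral_left) (auto simp: in_keys_iff)
  show ?thesis
    by (subst (1 2 3) *) (auto simp: lookup_add add sum.distrib dest: subsetD[OF Poly_Mapping.keys_add])
qed

text \<open>Splitting both factors into monomials reduces this to single terms.
  \<open>in_var\<close>, \<open>in_xy\<close> and \<open>tuple\<close> all have this shape.\<close>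

lemma sum_keys_mult:
  fixes f :: "'a::monoid_add \<Rightarrow> 'b::semiring_0 \<Rightarrow> 'c::comm_semiring_0"
  assumes f0: "\<And>s. f s 0 = 0" and add: "\<And>s a b. f s (a + b) = f s a + f s b"
    and mult: "\<And>s t a b. f (s + t) (a * b) = f s a * f t b"
  shows "(\<Sum>s\<in>Poly_Mapping.keys (p * q). f s (Poly_Mapping.lookup (p * q) s))
    = (\<Sum>s\<in>Poly_Mapping.keys p. f s (Poly_Mapping.lookup p s))
      * (\<Sum>s\<in>Poly_Mapping.keys q. f s (Poly_Mapping.lookup q s))"
proof -
  let ?e = "\<lambda>p. \<Sum>s\<in>Poly_Mapping.keys p. f s (Poly_Mapping.lookup p s)"
  have single: "?e (Poly_Mapping.single s a) = f s a" for s a by (simp add: f0)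
  have sum: "?e (sum g A) = (\<Sum>x\<in>A. ?e (g x))" for g :: "'a \<Rightarrow> 'a \<Rightarrow>\<^sub>0 'b" and A
    by (induction A rule: infinite_finite_induct) (simp_all add: sum_keys_add[of f, OF f0 add])
  have singles: "p = (\<Sum>s\<in>Poly_Mapping.keys p. Poly_Mapping.single s (Poly_Mapping.lookup p s))"
    for p :: "'a \<Rightarrow>\<^sub>0 'b"
    by (rule poly_mapping_eqI) (auto simp: lookup_sum lookup_single when_def in_keys_iff)
  have "p * q = (\<Sum>s\<in>Poly_Mapping.keys p. \<Sum>t\<in>Poly_Mapping.keys q.
      Poly_Mapping.single (s + t) (Poly_Mapping.lookup p s * Poly_Mapping.lookup q t))"
  proof -
    have "(\<Sum>s\<in>Poly_Mapping.keys p. Poly_Mapping.single s (Poly_Mapping.lookup p s))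
        * (\<Sum>t\<in>Poly_Mapping.keys q. Poly_Mapping.single t (Poly_Mapping.lookup q t))
      = (\<Sum>s\<in>Poly_Mapping.keys p. \<Sum>t\<in>Poly_Mapping.keys q.
          Poly_Mapping.single (s + t) (Poly_Mapping.lookup p s * Poly_Mapping.lookup q t))"
      by (simp add: sum_product mult_single)
    then show ?thesis by (simp only: singles[symmetric])
  qed
  then show ?thesis by (simp only: sum single mult sum_product)
qed

lemma R_0: "0 \<in> R n"
  by (simp add: R_def)

lemma Const_0 [simp]: "Const 0 = 0"
  by (simp add: Const_def)

lemma Const_1 [simp]: "Const 1 = 1"
  by (simp add: Const_def)

lemma Const_add: "Const (a + b) = Const a + Const b"
  by (simp add: Const_def single_add)

lemma Const_mult: "Const (a * b) = Const a * Const b"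
  by (simp add: Const_def mult_single)

lemma Const_uminus: "Const (- a) = - Const a"
  by (simp add: Const_def single_uminus)

lemma Const_eq_0_iff [simp]: "Const a = 0 \<longleftrightarrow> a = 0"
  unfolding Const_def by (metis lookup_single_eq lookup_zero single_zero)

text \<open>Constants and variables generate \<open>R n\<close> as a ring, so identities between
  homomorphisms or derivations need checking only there.\<close>

lemma R_induct [consumes 1, case_names Const Var add mult]:
  fixes p :: "'k::comm_ring_1 mpoly"
  assumes p: "p \<in> R n"
    and Const: "\<And>c. P (Const c)" and Var: "\<And>i. i \<in> {1..n} \<Longrightarrow> P (Var i)"
    and add: "\<And>p q. p \<in> R n \<Longrightarrow> q \<in> R n \<Longrightarrow> P p \<Longrightarrow> P q \<Longrightarrow> P (p + q)"
    and mult: "\<And>p q. p \<in> R n \<Longrightarrow> q \<in> R n \<Longrightarrow> P p \<Longrightarrow> P q \<Longrightarrow> P (p * q)"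
  shows "P p"
proof -
  have P0: "P 0" and P1: "P 1" using Const[of 0] Const[of 1] by simp_all
  have pow: "P (p ^ k)" if "p \<in> R n" "P p" for p k
    using that by (induction k) (auto simp: P1 R_power mult)
  have monom: "P (Poly_Mapping.single s a)" if "Poly_Mapping.keys s \<subseteq> {1..n}" for s a
  proof -
    have "Poly_Mapping.single s a 
        = Const a * (\<Prod>i\<in>Poly_Mapping.keys s. Var i ^ Poly_Mapping.lookup s i)"
    proof -
      have Vp: "Var i ^ k = Poly_Mapping.single (Poly_Mapping.single i k) (1::'k)" for i k
        by (induction k) (simp_all add: Var_def mult_single flip: single_add)
      have "(\<Prod>i\<in>A. Var i ^ Poly_Mapping.lookup s i)
          = Poly_Mapping.single (\<Sum>i\<in>A. Poly_Mapping.single i (Poly_Mapping.lookup s i)) (1::'k)" for A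
        by (induction A rule: infinite_finite_induct) (simp_all add: Vp mult_single)
      moreover have "(\<Sum>i\<in>Poly_Mapping.keys s. Poly_Mapping.single i (Poly_Mapping.lookup s i)) = s"
        by (rule poly_mapping_eqI) (auto simp: lookup_sum lookup_single when_def in_keys_iff)
      ultimately show ?thesis by (simp add: Const_def mult_single)
    qed
    moreover have "(\<Prod>i\<in>A. Var i ^ Poly_Mapping.lookup s i :: 'k mpoly) \<in> R n
        \<and> P (\<Prod>i\<in>A. Var i ^ Poly_Mapping.lookup s i)"
      if "A \<subseteq> {1..n}" for A
      using finite_subset[OF that finite_atLeastAtMost] that
      by (induction A rule: finite_induct) (auto simp: R_1 P1 intro!: R_mult mult pow R_power R_Var Var)
    ultimately show ?thesis using that by (simp add: mult R_Const Const)
  qed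
  have "sum (\<lambda>s. Poly_Mapping.single s (Poly_Mapping.lookup p s)) A \<in> R n
      \<and> P (sum (\<lambda>s. Poly_Mapping.single s (Poly_Mapping.lookup p s)) A)" if "A \<subseteq> Poly_Mapping.keys p" for A
    using finite_subset[OF that finite_keys] that
  proof (induction A rule: finite_induct)
    case empty
    then show ?case by (simp add: P0 R_0)
  next
    case (insert s A)
    then have s: "Poly_Mapping.keys s \<subseteq> {1..n}" using p by (auto simp: R_def)
    then have "Poly_Mapping.single s (Poly_Mapping.lookup p s) \<in> R n" by (simp add: R_def)
    with insert s show ?case by (auto intro!: R_add add monom)
  qed
  from this[OF subset_refl] show ?thesis by (simp flip: mpoly_sum_singles)
qed

lemma d_add: "d m \<alpha> n (p + q) = d m \<alpha> n p + d m \<alpha> n q"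
  by (simp add: d_def pderivative_add distrib_left sum.distrib add_ac)

lemma d_mult: "d m \<alpha> n (p * q) = p * d m \<alpha> n q + d m \<alpha> n p * q"
  by (simp add: d_def pderivative_mult distrib_left distrib_right sum.distrib
        sum_distrib_left sum_distrib_right mult.left_commute mult.assoc add_ac)

lemma d_Const [simp]: "d m \<alpha> n (Const c) = 0"
  by (simp add: d_def)

lemma d_0 [simp]: "d m \<alpha> n 0 = 0"
  by (simp add: d_def)

lemma d_uminus: "d m \<alpha> n (- p) = - d m \<alpha> n p"
  using d_add[of m \<alpha> n p "- p"] by (simp add: eq_neg_iff_add_eq_0 add.commute)

lemma d_diff: "d m \<alpha> n (p - q) = d m \<alpha> n p - d m \<alpha> n q"
  using d_add[of m \<alpha> n p "- q"] by (simp add: d_uminus)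

lemma d_closed: "n \<ge> 2 \<Longrightarrow> p \<in> R n \<Longrightarrow> d m \<alpha> n p \<in> R n"
  using k_derivation_d[of n m \<alpha>] by (auto simp: k_derivation_def)

text \<open>Both sides obey the Leibniz rule and agree at the variables of
  \<open>R n'\<close>.\<close>

lemma d_restrict:
  assumes "p \<in> R n'" "2 \<le> n'" "n' \<le> n"
  shows "d m \<alpha> n p = d m \<alpha> n' p"
  using assms(1)
proof (induction rule: R_induct)
  case (Var i)
  with assms(2,3) consider "i = 1" | "i = 2" | "i \<in> {3..n'}" "i \<in> {3..n}" by force
  then show ?case by cases (simp_all add: d_Var_1[unfolded One_nat_def] d_Var_2 d_Var)
qed (simp_all add: d_add d_mult)

section \<open>Splitting off one variable\<close>

text \<open>\<open>in_var j p\<close> is \<open>p\<close> as a polynomial in \<open>x\<^sub>j\<close> over the polynomials in the other variables.\<close>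

definition in_var :: "nat \<Rightarrow> 'k::comm_ring_1 mpoly \<Rightarrow> 'k mpoly poly" where
  "in_var j p = (\<Sum>s\<in>Poly_Mapping.keys p.
     monom (Poly_Mapping.single (s - Poly_Mapping.single j (Poly_Mapping.lookup s j)) (Poly_Mapping.lookup p s))
       (Poly_Mapping.lookup s j))"

lemma in_var_add: "in_var j (p + q) = in_var j p + in_var j q"
  unfolding in_var_def by (rule sum_keys_add) (simp_all add: single_add add_monom)

lemma in_var_mult: "in_var j (p * q) = in_var j p * in_var j q"
  unfolding in_var_def
proof (rule sum_keys_mult)
  fix s t :: "nat \<Rightarrow>\<^sub>0 nat" and a b :: 'a
  have "s + t - Poly_Mapping.single j (Poly_Mapping.lookup (s + t) j)
      = (s - Poly_Mapping.single j (Poly_Mapping.lookup s j)) + (t - Poly_Mapping.single j (Poly_Mapping.lookup t j))"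
    by (rule poly_mapping_eqI) (auto simp: lookup_add lookup_minus lookup_single when_def)
  then show "monom (Poly_Mapping.single (s + t - Poly_Mapping.single j (Poly_Mapping.lookup (s + t) j)) (a * b))
        (Poly_Mapping.lookup (s + t) j)
      = monom (Poly_Mapping.single (s - Poly_Mapping.single j (Poly_Mapping.lookup s j)) a) (Poly_Mapping.lookup s j)
        * monom (Poly_Mapping.single (t - Poly_Mapping.single j (Poly_Mapping.lookup t j)) b) (Poly_Mapping.lookup t j)"
    by (simp add: mult_monom mult_single lookup_add)
qed (simp_all add: single_add add_monom)

lemma in_var_Const [simp]: "in_var j (Const c) = [:Const c:]"
  by (cases "c = 0") (simp_all add: in_var_def Const_def monom_0)

lemma in_var_0 [simp]: "in_var j 0 = 0"
  by (simp add: in_var_def)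

lemma in_var_1 [simp]: "in_var j 1 = 1"
  using in_var_Const[of j 1] by (simp add: pCons_one)

lemma in_var_Var: "in_var j (Var i) = (if i = j then [:0, 1:] else [:Var i:])"
proof (cases "i = j")
  case True
  then show ?thesis
    by (simp add: in_var_def Var_def monom_altdef)
next
  case False
  have "Poly_Mapping.single i 1 - Poly_Mapping.single j (0::nat) = Poly_Mapping.single i 1"
    by simp
  with False show ?thesis
    by (simp add: in_var_def Var_def monom_0 lookup_single)
qed

lemma in_var_power: "in_var j (p ^ k) = in_var j p ^ k"
  by (induction k) (simp_all add: in_var_mult)

lemma in_var_uminus: "in_var j (- p) = - in_var j p"
  using in_var_add[of j p "- p"] by (simp add: eq_neg_iff_add_eq_0 add.commute)

lemma in_var_diff: "in_var j (p - q) = in_var j p - in_var j q"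
  using in_var_add[of j p "- q"] by (simp add: in_var_uminus)

lemma poly_in_var: "p \<in> R n \<Longrightarrow> poly (in_var j p) (Var j) = p"
  by (induction rule: R_induct) (auto simp: in_var_add in_var_mult in_var_Var)

lemma coeff_in_var_closed:
  assumes "p \<in> R (Suc n)"
  shows "coeff (in_var (Suc n) p) i \<in> R n"
  using assms
proof (induction arbitrary: i rule: R_induct)
  case (Const c)
  then show ?case by (auto simp: coeff_pCons R_Const R_0 split: nat.split)
next
  case (Var j)
  then show ?case
    by (auto simp: in_var_Var coeff_pCons R_1 R_0 intro!: R_Var split: nat.split)
next
  case (add p q)
  then show ?case by (simp add: in_var_add R_add)
next
  case (mult p q)
  then show ?case by (simp add: in_var_mult coeff_mult R_sum R_mult)
qed

text \<open>The derivation \<open>d m \<alpha> (n + 1)\<close>, transported to polynomials in \<open>x\<^sub>n\<^sub>+\<^sub>1\<close>.\<close>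

definition d_poly :: "nat \<Rightarrow> nat \<Rightarrow> nat \<Rightarrow> 'k::field_char_0 mpoly poly \<Rightarrow> 'k mpoly poly" where
  "d_poly m \<alpha> n P = map_poly (d m \<alpha> n) P + [:Var n:] * pderiv P"

lemma coeff_d_poly:
  "coeff (d_poly m \<alpha> n P) i = d m \<alpha> n (coeff P i) + Var n * (of_nat (Suc i) * coeff P (Suc i))"
  by (simp add: d_poly_def coeff_map_poly coeff_pderiv)

lemma d_poly_add: "d_poly m \<alpha> n (P + Q) = d_poly m \<alpha> n P + d_poly m \<alpha> n Q"
  by (rule poly_eqI) (simp add: coeff_d_poly d_add algebra_simps)

lemma d_poly_mult: "d_poly m \<alpha> n (P * Q) = P * d_poly m \<alpha> n Q + d_poly m \<alpha> n P * Q"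
proof -
  have "map_poly (d m \<alpha> n) (P * Q) = P * map_poly (d m \<alpha> n) Q + map_poly (d m \<alpha> n) P * Q"
    by (rule leibniz_map_poly) (simp_all add: d_add d_mult)
  then show ?thesis by (simp add: d_poly_def pderiv_mult algebra_simps del: mult_pCons_left)
qed

text \<open>It suffices to compare generators. The factor \<open>Var n\<close> in
  \<open>d_poly\<close> is the derivative of the new variable, as n + 1 \<ge> 3.\<close>

lemma in_var_d:
  assumes "n \<ge> 2" "p \<in> R (Suc n)"
  shows "in_var (Suc n) (d m \<alpha> (Suc n) p) = d_poly m \<alpha> n (in_var (Suc n) p)"
  using assms(2)
proof (induction rule: R_induct)
  case (Const c)
  then show ?case by (simp add: d_poly_def map_poly_pCons pderiv_pCons)
next
  case (Var j)
  then consider "j = 1" | "j = 2" | "j \<in> {3..n}" "j \<in> {3..Suc n}" | "j = Suc n" by force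
  then show ?case
  proof cases
    case 1
    then show ?thesis using assms(1)
      by (auto simp: d_Var_1[unfolded One_nat_def] in_var_Var in_var_diff in_var_mult in_var_power
          d_poly_def map_poly_pCons
          pderiv_pCons poly_const_pow one_pCons mult.commute)
  next
    case 2
    then show ?thesis using assms(1)
      by (auto simp: d_Var_2 in_var_Var in_var_power d_poly_def map_poly_pCons
          pderiv_pCons poly_const_pow)
  next
    case 3
    then show ?thesis using assms(1)
      by (auto simp: d_Var in_var_Var d_poly_def map_poly_pCons pderiv_pCons)
  next
    case 4
    have "d m \<alpha> n 1 = (0 :: 'a mpoly)" using d_Const[of m \<alpha> n "1 :: 'a"] by simp
    then show ?thesis using assms(1) 4
      by (auto simp: d_Var in_var_Var d_poly_def map_poly_pCons pderiv_pCons)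
  qed
qed (simp_all add: d_add d_mult in_var_add in_var_mult d_poly_add d_poly_mult)

text \<open>On \<open>R 2\<close>, this is the identification with \<open>k[x][y]\<close>; the other variables are set to \<open>1\<close>.\<close>

definition in_xy :: "'k::comm_ring_1 mpoly \<Rightarrow> 'k poly poly" where
  "in_xy p = (\<Sum>s\<in>Poly_Mapping.keys p.
     monom (monom (Poly_Mapping.lookup p s) (Poly_Mapping.lookup s 1)) (Poly_Mapping.lookup s 2))"

lemma in_xy_add: "in_xy (p + q) = in_xy p + in_xy q"
  unfolding in_xy_def by (rule sum_keys_add) (simp_all add: add_monom)

lemma in_xy_mult: "in_xy (p * q) = in_xy p * in_xy q"
  unfolding in_xy_def by (rule sum_keys_mult) (simp_all add: add_monom mult_monom lookup_add)

lemma in_xy_0 [simp]: "in_xy 0 = 0"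
  by (simp add: in_xy_def)

lemma in_xy_Const [simp]: "in_xy (Const c) = [:[:c:]:]"
  by (cases "c = 0") (simp_all add: in_xy_def Const_def monom_0)

lemma in_xy_1 [simp]: "in_xy 1 = 1"
  using in_xy_Const[of 1] by (simp add: pCons_one)

lemma in_xy_Var_1: "in_xy (Var 1) = [:[:0, 1:]:]"
  by (simp add: in_xy_def Var_def lookup_single monom_altdef)

lemma in_xy_Var_2: "in_xy (Var 2) = [:0, 1:]"
  by (simp add: in_xy_def Var_def lookup_single monom_altdef)

lemma in_xy_power: "in_xy (p ^ k) = in_xy p ^ k"
  by (induction k) (simp_all add: in_xy_mult)

lemma in_xy_uminus: "in_xy (- p) = - in_xy p"
  using in_xy_add[of p "- p"] by (simp add: eq_neg_iff_add_eq_0 add.commute)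

lemma in_xy_diff: "in_xy (p - q) = in_xy p - in_xy q"
  using in_xy_add[of p "- q"] by (simp add: in_xy_uminus)

text \<open>On \<open>R 2\<close> an exponent vector is determined by its entries at 1 and 2, so
  distinct monomials have distinct images.\<close>

lemma in_xy_eq_0:
  assumes "p \<in> R 2" "in_xy p = 0"
  shows "p = 0"
proof (rule poly_mapping_eqI)
  fix t
  show "Poly_Mapping.lookup p t = Poly_Mapping.lookup 0 t"
  proof (cases "t \<in> Poly_Mapping.keys p")
    case True
    have eq: "s = t" if "s \<in> Poly_Mapping.keys p" "Poly_Mapping.lookup s 1 = Poly_Mapping.lookup t 1"
      "Poly_Mapping.lookup s 2 = Poly_Mapping.lookup t 2" for s
    proof (rule poly_mapping_eqI)
      fix i
      have "Poly_Mapping.keys s \<subseteq> {1..2}" "Poly_Mapping.keys t \<subseteq> {1..2}"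
        using True that(1) assms(1) by (auto simp: R_def)
      moreover have "i \<in> {1..2::nat} \<Longrightarrow> i = 1 \<or> i = 2" by force
      ultimately show "Poly_Mapping.lookup s i = Poly_Mapping.lookup t i" using that(2,3)
        by (metis in_keys_iff subsetD)
    qed
    have "0 = coeff (coeff (in_xy p) (Poly_Mapping.lookup t 2)) (Poly_Mapping.lookup t 1)"
      by (simp add: assms(2))
    also have "\<dots> = (\<Sum>s\<in>Poly_Mapping.keys p. if s = t then Poly_Mapping.lookup p s else 0)"
      unfolding in_xy_def coeff_sum
      by (intro sum.cong refl) (use eq in \<open>auto simp del: One_nat_def\<close>)
    also have "\<dots> = Poly_Mapping.lookup p t" using True by simp
    finally show ?thesis by simp
  qed (simp add: in_keys_iff)
qed

lemma in_xy_inject: "p \<in> R 2 \<Longrightarrow> q \<in> R 2 \<Longrightarrow> in_xy p = in_xy q \<Longrightarrow> p = q"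
  using in_xy_eq_0[of "p - q"] by (simp add: R_diff in_xy_diff)

lemma in_xy_d:
  assumes "p \<in> R 2"
  shows "in_xy (d m \<alpha> 2 p) = dxy m \<alpha> (in_xy p)"
  using assms
proof (induction rule: R_induct)
  case (Const c)
  then show ?case by (simp add: dxy_def map_poly_pCons pderiv_pCons)
next
  case (Var i)
  from Var have "i = 1 \<or> i = 2" by force
  then show ?case
  proof
    assume i: "i = 1"
    have "in_xy (d m \<alpha> 2 (Var i :: 'a mpoly)) = 1 - [:[:0, 1:]:] * [:0, 1:] ^ \<alpha>"
      unfolding i d_Var_1 by (simp only: in_xy_diff in_xy_mult in_xy_power in_xy_Var_1 in_xy_Var_2 in_xy_1)
    also have "\<dots> = 1 - monom (monom 1 1) \<alpha>"
      by (simp add: monom_altdef)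
    also have "\<dots> = dxy m \<alpha> (in_xy (Var i))"
      unfolding i in_xy_Var_1 by (simp add: dxy_def map_poly_pCons pderiv_pCons pCons_one)
    finally show ?thesis .
  next
    assume i: "i = 2"
    have "in_xy (d m \<alpha> 2 (Var i :: 'a mpoly)) = [:[:0, 1:]:] ^ m"
      unfolding i d_Var_2 by (simp only: in_xy_power in_xy_Var_1)
    also have "\<dots> = dxy m \<alpha> (in_xy (Var i))"
      unfolding i in_xy_Var_2
      by (simp add: dxy_def map_poly_pCons pderiv_pCons poly_const_pow monom_altdef)
    finally show ?thesis .
  qed
qed (simp_all add: d_add d_mult in_xy_add in_xy_mult dxy_add dxy_mult)

section \<open>The isotropy group\<close>

text \<open>If F had degree r + 1 in x_(n+1), its top coefficient would have a constant derivative,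
  hence be a nonzero constant c. The next coefficient would then have derivative -(r + 1) c x_n plus
  a constant. The term a x_n in the statement lets the induction hypothesis refute this.\<close>

lemma d_eq_affine_last_var:
  fixes F :: "'k::field_char_0 mpoly"
  assumes m: "m \<ge> 2" and \<alpha>: "\<alpha> \<ge> 1" and "n \<ge> 2"
    and "F \<in> R n" and "d m \<alpha> n F = Const a * Var n + Const b"
  shows "a = 0 \<and> b = 0 \<and> (\<exists>c. F = Const c)"
  using \<open>n \<ge> 2\<close> assms(4,5)
proof (induction n arbitrary: F a b rule: dec_induct)
  case base
  have "dxy m \<alpha> (in_xy F) = [:[:b:], [:a:]:]"
    by (simp add: in_xy_d[symmetric] base in_xy_add in_xy_mult in_xy_Var_2)
  from dxy_eq_affine_y[OF m \<alpha> this] obtain c where "a = 0" "b = 0" "in_xy F = in_xy (Const c)"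
    by auto
  with base(1) show ?case using in_xy_inject[OF base(1) R_Const] by blast
next
  case (step n)
  let ?P = "in_var (Suc n) F"
  have P: "d m \<alpha> n (coeff ?P i) + Var n * (of_nat (Suc i) * coeff ?P (Suc i))
      = coeff [:Const b, Const a:] i" for i
    unfolding coeff_d_poly[symmetric] in_var_d[OF step.hyps(1) step.prems(1), symmetric] step.prems(2)
    by (simp add: in_var_add in_var_mult in_var_Var)
  have rhs: "\<exists>e. coeff [:Const b, Const a:] i = Const e" for i
    by (cases "i = 0 \<or> i = 1") (auto simp: coeff_pCons split: nat.splits intro: exI[of _ 0])
  have closed: "coeff ?P i \<in> R n" for i by (rule coeff_in_var_closed[OF step.prems(1)])
  have "degree ?P = 0"
  proof (rule ccontr)
    assume "degree ?P \<noteq> 0"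
    then obtain r where r: "degree ?P = Suc r" by (cases "degree ?P") auto
    obtain e where "coeff [:Const b, Const a:] (Suc r) = Const e" using rhs by blast
    then have "d m \<alpha> n (coeff ?P (Suc r)) = Const 0 * Var n + Const e"
      using P[of "Suc r"] by (simp add: coeff_eq_0 r)
    from step.IH[OF closed this] obtain c where c: "coeff ?P (Suc r) = Const c" by blast
    with r have "c \<noteq> 0" by (metis Const_0 degree_0 leading_coeff_0_iff nat.distinct(1))
    obtain e' where "coeff [:Const b, Const a:] r = Const e'" using rhs by blast
    moreover have "of_nat k = Const (of_nat k :: 'k)" for k
      by (induction k) (simp_all add: Const_add)
    ultimately have "d m \<alpha> n (coeff ?P r) = Const (- (of_nat (Suc r) * c)) * Var n + Const e'"
      using P[of r] unfolding c by (simp add: Const_mult Const_uminus algebra_simps del: of_nat_Suc)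
    from step.IH[OF closed this] have "of_nat (Suc r) * c = 0" by simp
    with \<open>c \<noteq> 0\<close> show False by (simp del: of_nat_Suc)
  qed
  then obtain q where q: "?P = [:q:]" by (rule degree_eq_zeroE)
  have "F = q" using poly_in_var[OF step.prems(1), of "Suc n"] q by simp
  have "a = 0" using P[of 1] by (simp add: q)
  moreover have "d m \<alpha> n q = Const 0 * Var n + Const b" using P[of 0] by (simp add: q)
  moreover have "q \<in> R n" using closed[of 0] by (simp add: q)
  ultimately show ?case unfolding \<open>F = q\<close> using step.IH by blast
qed

text \<open>In x_(n+1), the derivation does not raise degrees. The first equation yields deg A +
  \<alpha> deg B \<le> deg A for nonzero B, so deg B = 0; the second then yields m deg A \<le>
  0.\<close>

lemma commuting_pair_drop_var:
  fixes g\<^sub>1 g\<^sub>2 :: "'k::field_char_0 mpoly"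
  assumes m: "m \<ge> 1" and \<alpha>: "\<alpha> \<ge> 1" and n: "n \<ge> 2"
    and R: "g\<^sub>1 \<in> R (Suc n)" "g\<^sub>2 \<in> R (Suc n)"
    and g\<^sub>1: "d m \<alpha> (Suc n) g\<^sub>1 = 1 - g\<^sub>1 * g\<^sub>2 ^ \<alpha>" and g\<^sub>2: "d m \<alpha> (Suc n) g\<^sub>2 = g\<^sub>1 ^ m"
  shows "g\<^sub>1 \<in> R n \<and> g\<^sub>2 \<in> R n"
proof -
  let ?A = "in_var (Suc n) g\<^sub>1" and ?B = "in_var (Suc n) g\<^sub>2"
  have A: "d_poly m \<alpha> n ?A = 1 - ?A * ?B ^ \<alpha>"
    unfolding in_var_d[OF n R(1), symmetric] g\<^sub>1 by (simp add: in_var_diff in_var_mult in_var_power)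
  have B: "d_poly m \<alpha> n ?B = ?A ^ m"
    unfolding in_var_d[OF n R(2), symmetric] g\<^sub>2 by (simp add: in_var_power)
  have d_le: "degree (d_poly m \<alpha> n P) \<le> degree P" for P
    by (rule degree_le) (simp add: coeff_d_poly coeff_eq_0)
  have A0: "?A \<noteq> 0"
  proof
    assume "?A = 0"
    with A have "d_poly m \<alpha> n 0 = (1 :: 'k mpoly poly)" by simp
    then show False by (simp add: d_poly_def)
  qed
  have B_deg: "degree ?B = 0"
  proof (cases "?B = 0")
    case False
    have "degree (?A * ?B ^ \<alpha>) = degree (1 - d_poly m \<alpha> n ?A)" by (simp add: A)
    also have "\<dots> \<le> degree ?A" by (rule degree_diff_le) (simp_all add: d_le)
    finally have "degree ?A + \<alpha> * degree ?B \<le> degree ?A"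
      using A0 False by (simp add: degree_mult_eq degree_power_eq)
    with \<alpha> show ?thesis by simp
  qed simp
  have "m * degree ?A \<le> 0" using d_le[of ?B] A0 unfolding B B_deg by (simp add: degree_power_eq)
  with m have A_deg: "degree ?A = 0" by simp
  have drop: "g \<in> R n" if "g \<in> R (Suc n)" "degree (in_var (Suc n) g) = 0" for g :: "'k mpoly"
  proof -
    from that(2) obtain q where q: "in_var (Suc n) g = [:q:]" by (rule degree_eq_zeroE)
    then have "g = coeff (in_var (Suc n) g) 0"
      using poly_in_var[OF that(1), of "Suc n"] by simp
    then show ?thesis using coeff_in_var_closed[OF that(1), of 0] by simp
  qed
  show ?thesis using drop R A_deg B_deg by blast
qed

lemma commuting_pair:
  fixes g\<^sub>1 g\<^sub>2 :: "'k::field_char_0 mpoly"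
  assumes m: "m \<ge> 2" and \<alpha>: "\<alpha> \<ge> 1" and "n \<ge> 2"
    and "g\<^sub>1 \<in> R n" "g\<^sub>2 \<in> R n"
    and "d m \<alpha> n g\<^sub>1 = 1 - g\<^sub>1 * g\<^sub>2 ^ \<alpha>" and "d m \<alpha> n g\<^sub>2 = g\<^sub>1 ^ m"
  shows "g\<^sub>1 = Var 1 \<and> g\<^sub>2 = Var 2"
  using assms(3-)
proof (induction n rule: dec_induct)
  case base
  have "dxy m \<alpha> (in_xy g\<^sub>1) = 1 - in_xy g\<^sub>1 * in_xy g\<^sub>2 ^ \<alpha>"
    by (simp add: in_xy_d[symmetric] base in_xy_diff in_xy_mult in_xy_power)
  moreover have "dxy m \<alpha> (in_xy g\<^sub>2) = in_xy g\<^sub>1 ^ m"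
    by (simp add: in_xy_d[symmetric] base in_xy_power)
  ultimately have "in_xy g\<^sub>1 = in_xy (Var 1)" "in_xy g\<^sub>2 = in_xy (Var 2)"
    using dxy_commuting_pair[OF m \<alpha>] unfolding in_xy_Var_1 in_xy_Var_2 by blast+
  moreover have "Var 1 \<in> R 2" "Var 2 \<in> R 2" by (auto intro!: R_Var)
  ultimately show ?case using base(1,2) in_xy_inject by blast
next
  case (step n)
  have "m \<ge> 1" using m by simp
  from commuting_pair_drop_var[OF this \<alpha> step.hyps(1) step.prems]
  have R: "g\<^sub>1 \<in> R n" "g\<^sub>2 \<in> R n" by blast+
  have "d m \<alpha> n g = d m \<alpha> (Suc n) g" if "g \<in> R n" for g :: "'k mpoly"
    using that step.hyps(1) by (intro d_restrict[symmetric]) auto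
  with R step.prems(3,4) show ?case by (intro step.IH) simp_all
qed

section \<open>Substitution endomorphisms\<close>

lemma tuple_add: "p \<in> R n \<Longrightarrow> q \<in> R n \<Longrightarrow> tuple n g (p + q) = tuple n g p + tuple n g q"
  unfolding tuple_def
  by (simp add: R_add) (rule sum_keys_add, simp_all add: Const_add algebra_simps)

lemma tuple_mult: "p \<in> R n \<Longrightarrow> q \<in> R n \<Longrightarrow> tuple n g (p * q) = tuple n g p * tuple n g q"
  unfolding tuple_def
  by (simp add: R_mult)
    (rule sum_keys_mult, simp_all add: Const_add Const_mult lookup_add power_add prod.distrib algebra_simps)

lemma tuple_diff:
  assumes "p \<in> R n" "q \<in> R n"
  shows "tuple n g (p - q) = tuple n g p - tuple n g q"
  using tuple_add[OF R_diff[OF assms] assms(2), of g] by (simp add: eq_diff_eq)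

lemma tuple_closed:
  assumes "p \<in> R n" "\<And>i. i \<in> {1..n} \<Longrightarrow> g i \<in> R n'"
  shows "tuple n g p \<in> R n'"
  using assms(1)
  by (induction rule: R_induct) (simp_all add: tuple_Const R_Const tuple_Var tuple_add tuple_mult
      R_add R_mult assms(2) del: One_nat_def)

text \<open>The images of the variables determine a homomorphism on \<open>R n\<close>; outside,
  both functions are \<open>undefined\<close>.\<close>

lemma hom_eq_tuple:
  assumes ext: "\<rho> \<in> extensional (R n)"
    and "\<And>p q. p \<in> R n \<Longrightarrow> q \<in> R n \<Longrightarrow> \<rho> (p + q) = \<rho> p + \<rho> q"
    and "\<And>p q. p \<in> R n \<Longrightarrow> q \<in> R n \<Longrightarrow> \<rho> (p * q) = \<rho> p * \<rho> q"
    and "\<And>c. \<rho> (Const c) = Const c"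
    and "\<And>i. i \<in> {1..n} \<Longrightarrow> \<rho> (Var i) = g i"
  shows "\<rho> = tuple n g"
proof (rule extensionalityI[OF ext])
  show "tuple n g \<in> extensional (R n)" by (simp add: tuple_def)
  fix p :: "'a mpoly"
  assume "p \<in> R n"
  then show "\<rho> p = tuple n g p"
    by (induction rule: R_induct)
      (simp_all add: assms tuple_Const tuple_Var tuple_add tuple_mult del: One_nat_def)
qed

text \<open>Translation by -c is the inverse. On the variables, commutation holds because x_n occurs
  in no \<open>d m \<alpha> n (Var i)\<close> and constants have derivative zero.\<close>

lemma translation_in_isotropy_group:
  fixes c :: "'k::field_char_0"
  assumes n: "n \<ge> 3"
  shows "tuple n (\<lambda>i. if i = n then Var n + Const c else Var i) \<in> isotropy_group n (d m \<alpha> n)"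
proof -
  define g where "g c = (\<lambda>i. if i = n then Var n + Const c else Var i)" for c :: 'k
  have g_closed: "g c i \<in> R n" if "i \<in> {1..n}" for c i
    using that by (auto simp: g_def intro!: R_add R_Const R_Var)
  have closed: "tuple n (g c) p \<in> R n" if "p \<in> R n" for c p
    using that g_closed by (rule tuple_closed)
  have Var_R: "(Var i :: 'k mpoly) \<in> R n" if "i \<in> {1..n}" for i using that by (rule R_Var)
  \<comment> \<open>The symmetric condition on c and c' covers both orders of composition.\<close>
  have inverse: "tuple n (g c') (tuple n (g c) p) = p" if "p \<in> R n" "c' + c = 0" for c c' p
    using that(1)
  proof (induction rule: R_induct)
    case (Var i)
    show ?case
    proof (cases "i = n")
      case True
      have "Var n + Const c' + Const c = Var n"
        using that(2) by (metis Const_0 Const_add add.assoc add.right_neutral)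
      then show ?thesis using Var True n
        by (simp add: tuple_Var tuple_add tuple_Const Var_R R_Const g_def del: One_nat_def)
    next
      case False
      then show ?thesis using Var by (simp add: tuple_Var g_def)
    qed
  qed (simp_all add: tuple_Const tuple_add tuple_mult closed)
  have bij: "bij_betw (tuple n (g c)) (R n) (R n)"
    by (rule bij_betw_byWitness[where f' = "tuple n (g (- c))"]) (auto simp: inverse closed)
  have power: "tuple n (g c) (p ^ k) = tuple n (g c) p ^ k" if "p \<in> R n" for p k
    using that tuple_Const[of n "g c" 1] by (induction k) (simp_all add: tuple_mult R_power)
  have "d m \<alpha> n (tuple n (g c) p) = tuple n (g c) (d m \<alpha> n p)" if "p \<in> R n" for p
    using that
  proof (induction rule: R_induct)
    case (Const a)
    show ?case using tuple_Const[of n "g c" 0] by (simp add: tuple_Const)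
  next
    case (Var i)
    have fixed: "tuple n (g c) (Var j) = Var j" if "j \<in> {1..<n}" for j
      using that by (simp add: tuple_Var g_def)
    from Var n consider "i = 1" | "i = 2" | "i \<in> {3..n}" by force
    then show ?case
    proof cases
      case 1
      have X: "(Var 1 :: 'k mpoly) \<in> R n" "(Var 2 :: 'k mpoly) \<in> R n" using n by (auto intro!: Var_R)
      have "tuple n (g c) 1 = 1" using tuple_Const[of n "g c" 1] by simp
      then have "tuple n (g c) (1 - Var 1 * Var 2 ^ \<alpha>) = 1 - Var 1 * Var 2 ^ \<alpha>"
        using n X fixed[of 1] fixed[of 2]
        by (simp add: tuple_diff tuple_mult power R_1 R_mult R_power del: One_nat_def)
      then show ?thesis using fixed[of 1] n unfolding 1 d_Var_1 by (simp add: d_Var_1 del: One_nat_def)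
    next
      case 2
      have "(Var 1 :: 'k mpoly) \<in> R n" using n by (auto intro!: Var_R)
      then show ?thesis using n fixed[of 1] fixed[of 2] unfolding 2
        by (simp add: d_Var_2 power del: One_nat_def)
    next
      case 3
      then have "tuple n (g c) (Var (i - 1)) = Var (i - 1)" by (intro fixed) auto
      moreover have "d m \<alpha> n (tuple n (g c) (Var i)) = d m \<alpha> n (Var i :: 'k mpoly)"
        using Var by (simp add: tuple_Var g_def d_add)
      ultimately show ?thesis using 3 by (simp add: d_Var)
    qed
  next
    case (add p q)
    then show ?case using n by (simp add: tuple_add d_add d_closed)
  next
    case (mult p q)
    then show ?case using n by (simp add: tuple_add tuple_mult d_mult d_closed R_mult)
  qed
  then show ?thesis using bij unfolding g_def[symmetric] isotropy_group_def Aut_def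
    by (simp add: tuple_add tuple_mult tuple_Const) (simp add: tuple_def)
qed

theorem theorem4p3:
  fixes m \<alpha> n :: nat
  assumes "m \<ge> 2" and "\<alpha> \<ge> 1" and "n \<ge> 3"
  shows "isotropy_group n (d m \<alpha> n :: 'k::field_char_0 mpoly \<Rightarrow> 'k mpoly) =
    {tuple n (\<lambda>i. if i = n then Var n + Const c else Var i) | c. c \<in> UNIV}"
proof (intro subset_antisym subsetI)
  fix \<rho> :: "'k mpoly \<Rightarrow> 'k mpoly"
  assume "\<rho> \<in> isotropy_group n (d m \<alpha> n)"
  then have ext: "\<rho> \<in> extensional (R n)"
    and closed: "\<And>p. p \<in> R n \<Longrightarrow> \<rho> p \<in> R n"
    and add: "\<And>p q. p \<in> R n \<Longrightarrow> q \<in> R n \<Longrightarrow> \<rho> (p + q) = \<rho> p + \<rho> q"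
    and mult: "\<And>p q. p \<in> R n \<Longrightarrow> q \<in> R n \<Longrightarrow> \<rho> (p * q) = \<rho> p * \<rho> q"
    and Const: "\<And>c. \<rho> (Const c) = Const c"
    and comm: "\<And>p. p \<in> R n \<Longrightarrow> d m \<alpha> n (\<rho> p) = \<rho> (d m \<alpha> n p)"
    by (auto simp: isotropy_group_def Aut_def bij_betw_def)
  have power: "\<rho> (p ^ k) = \<rho> p ^ k" if "p \<in> R n" for p k
    using that Const[of 1] by (induction k) (simp_all add: mult R_power)
  have X: "(Var i :: 'k mpoly) \<in> R n" if "i \<in> {1..n}" for i using that by (rule R_Var)
  have X1: "(Var 1 :: 'k mpoly) \<in> R n" and X2: "(Var 2 :: 'k mpoly) \<in> R n"
    using \<open>n \<ge> 3\<close> by (auto intro!: X)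
  have diff: "\<rho> (p - q) = \<rho> p - \<rho> q" if "p \<in> R n" "q \<in> R n" for p q
    using add[OF R_diff[OF that] that(2)] by (simp add: eq_diff_eq)
  have "\<rho> 1 = 1" using Const[of 1] by simp
  then have "\<rho> (1 - Var 1 * Var 2 ^ \<alpha>) = 1 - \<rho> (Var 1) * \<rho> (Var 2) ^ \<alpha>"
    using X1 X2 by (simp add: diff mult power R_1 R_mult R_power del: One_nat_def)
  then have "d m \<alpha> n (\<rho> (Var 1)) = 1 - \<rho> (Var 1) * \<rho> (Var 2) ^ \<alpha>"
    by (simp only: comm[OF X1] d_Var_1)
  moreover have "d m \<alpha> n (\<rho> (Var 2)) = \<rho> (Var 1) ^ m"
    by (simp only: comm[OF X2] d_Var_2 power[OF X1])
  ultimately have \<rho>12: "\<rho> (Var 1) = Var 1" "\<rho> (Var 2) = Var 2"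
    using commuting_pair[OF assms(1,2) _ closed[OF X1] closed[OF X2]] \<open>n \<ge> 3\<close> by auto
  \<comment> \<open>The difference \<open>\<rho> (Var i) - Var i\<close> has the constant derivative
    b. So b must vanish, while x_i is moved by a constant only.\<close>
  have step: "b = 0 \<and> (\<exists>c. \<rho> (Var i) = Var i + Const c)"
    if "i \<in> {3..n}" "\<rho> (Var (i - 1)) = Var (i - 1) + Const b" for i b
  proof -
    have Xi: "(Var i :: 'k mpoly) \<in> R n" using that by (intro X) auto
    have eq: "d m \<alpha> n (\<rho> (Var i) - Var i) = Const 0 * Var n + Const b"
      using that by (simp add: d_diff comm[OF Xi] d_Var)
    have "n \<ge> 2" using \<open>n \<ge> 3\<close> by simp
    from d_eq_affine_last_var[OF assms(1,2) this R_diff[OF closed[OF Xi] Xi] eq]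
    obtain c where "b = 0" "\<rho> (Var i) - Var i = Const c" by blast
    then show ?thesis by (simp add: diff_eq_eq add.commute exI[of _ c])
  qed
  have "\<exists>c. \<rho> (Var i) = Var i + Const c" if "i \<in> {2..n}" for i
    using that
  proof (induction i)
    case (Suc i)
    show ?case
    proof (cases "i = 1")
      case True
      then show ?thesis using \<rho>12 by (auto simp: numeral_2_eq_2 intro!: exI[of _ 0])
    next
      case False
      with Suc.prems Suc.IH obtain b where "\<rho> (Var i) = Var i + Const b" by auto
      then show ?thesis using step[of "Suc i" b] False Suc.prems by simp
    qed
  qed simp
  note translate = this
  \<comment> \<open>For 1 < i < n, \<open>step\<close> at i + 1 forces the constant of x_i to be
    zero; x_n has no successor, so its constant stays free.\<close>
  have \<rho>_below: "\<rho> (Var i) = Var i" if "i \<in> {1..<n}" for i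
  proof (cases "i = 1")
    case False
    with that obtain b where b: "\<rho> (Var i) = Var i + Const b" using translate[of i] by auto
    then have "b = 0" using step[of "Suc i" b] that False by simp
    with b show ?thesis by simp
  qed (use \<rho>12 in simp)
  obtain c where "\<rho> (Var n) = Var n + Const c" using translate[of n] \<open>n \<ge> 3\<close> by auto
  with \<rho>_below have "\<rho> = tuple n (\<lambda>i. if i = n then Var n + Const c else Var i)"
    by (intro hom_eq_tuple ext add mult Const) auto
  then show "\<rho> \<in> {tuple n (\<lambda>i. if i = n then Var n + Const c else Var i) | c. c \<in> UNIV}" by blast
next
  fix \<rho> :: "'k mpoly \<Rightarrow> 'k mpoly"
  assume "\<rho> \<in> {tuple n (\<lambda>i. if i = n then Var n + Const c else Var i) | c. c \<in> UNIV}"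
  then show "\<rho> \<in> isotropy_group n (d m \<alpha> n)"
    using translation_in_isotropy_group[OF \<open>n \<ge> 3\<close>] by auto
qed

end
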